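(* Let $q$ be an odd prime power that is a square. Consider the cyclic symmetric configuration $(q^2-1)_q$ associated to the starred affine plane of order $q$, whose points are the elements of $F_{q^2}^{*}$ and whose lines are the lines of $AG(2,q)=F_{q^2}$ not passing through $0$. Let $\xi$ be a primitive element of $F_{q^2}$, let $P_i=\xi^i$, and let $\sigma$ be multiplication by $\xi$. Then a line $\ell_0$ of the configuration can be chosen such that the following holds. Let $t$ be a divisor of $\sqrt q+1$, let $d=(q^2-1)/t$, and let $\mathbf{A}$ be the block double-circulant incidence matrix of this configuration obtained from the orbits of points and of lines under $\langle\sigma^t\rangle$. Let $w_0,w_1,\ldots,w_{t-1}$ be the weights of the circulant $d\times d$ blocks of $\mathbf{A}$. (i) Let $t=\sqrt q+1$. Then $w_0=1$, and for $j=1,2,\ldots,\sqrt q$: $w_j=\sqrt q-1$ for $j$ odd, $w_j=\sqrt q+1$ for $j$ even. (ii) Let $t=\frac12(\sqrt q+1)$ and $\sqrt q\equiv 1\pmod 4$. Then $w_0=\sqrt q$ and $w_1=w_2=\cdots=w_{t-1}=2\sqrt q$. (iii) Let $t=\frac12(\sqrt q+1)$ and $\sqrt q\equiv 3\pmod 4$. Then $w_0=\sqrt q+2$, and for $j=1,2,\ldots,\frac12(\sqrt q+1)-1$: $w_j=2\sqrt q-2$ for $j$ odd, $w_j=2\sqrt q+2$ for $j$ even. (iv) Let $t=\frac14(\sqrt q+1)$ and $\sqrt q\equiv 3\pmod 4$. - If $\frac14(\sqrt q+1)$ is odd, then $w_0=3\sqrt q$ and $w_1=w_2=\cdots=w_{t-1}=4\sqrt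 q$. - If $\frac14(\sqrt q+1)$ is even, then $w_0=3\sqrt q+4$, and for $j=1,2,\ldots,\frac14(\sqrt q+1)-1$: $w_j=4\sqrt q-4$ for $j$ odd, $w_j=4\sqrt q+4$ for $j$ even.
   Context: The affine plane $AG(2,q)$ is identified with $F_{q^2}$, viewed as a two-dimensional vector space over $F_q$; its lines are the cosets of the one-dimensional $F_q$-subspaces. The starred affine plane is obtained by removing the origin and all lines through the origin; it has $q^2-1$ points and $q^2-1$ lines, with $q$ points on each line and $q$ lines through each point. Multiplication by a primitive element $\xi$ of $F_{q^2}$ gives a permutation $\sigma$ of points mapping lines to lines and acting regularly on both points and lines. For $t$ dividing $q^2-1$ and $d=(q^2-1)/t$, the subgroup $\langle\sigma^t\rangle$ of order $d$ has the point orbits $O_i=\{\sigma^{i+mt}(P_0)\mid 0\le m\le d-1\}$ and the line orbits $L_i=\{\sigma^{i+mt}(\ell_0)\mid 0\le m\le d-1\}$, $i=0,\ldots,t-1$. Put $w_u=|\ell_0\cap O_u|$ for $u=0,\ldots,t-1$. When lines and points are ordered orbit by orbit (each orbit in the displayed order $m=0,1,\ldots,d-1$), the incidence matrix $\mathbf{A}$ (rows = lines, columns = points) is a $t\times t$ array of $d\times d$ circulant blocks $\mathbf{C}_{i,j}$, where $\mathbf{C}_{i,j}$ has weight (number of ones in each row) $w_{j-i \bmod t}$. The weights $w_0,\ldots,w_{t-1}$ in the statement are these numbers. *)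

theory Defs
  imports "HOL-Library.Cardinality" "HOL-Number_Theory.Prime_Powers" "Jordan_Normal_Form.Matrix"
begin

definition is_subfield :: "'a::field set \<Rightarrow> bool" where
  "is_subfield K \<longleftrightarrow> 0 \<in> K \<and> 1 \<in> K \<and>
     (\<forall>x\<in>K. \<forall>y\<in>K. x - y \<in> K \<and> x * y \<in> K) \<and> (\<forall>x\<in>K. inverse x \<in> K)"

definition primitive_element :: "'a::field \<Rightarrow> bool" where
  "primitive_element \<xi> \<longleftrightarrow> range (\<lambda>i::nat. \<xi> ^ i) = - {0}"

text \<open>The affine plane whose point set is the whole field, as a vector space over the subfield \<open>K\<close>
  (of dimension two in the application): its lines are the cosets
  \<open>a + K b\<close>, \<open>b \<noteq> 0\<close>, of the one-dimensional \<open>K\<close>-subspaces.\<close>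

definition affine_lines :: "'a::field set \<Rightarrow> 'a set set" where
  "affine_lines K = {l. \<exists>a b. b \<noteq> 0 \<and> l = {a + c * b | c. c \<in> K}}"

text \<open>The points of the starred plane are the nonzero field elements.\<close>

definition starred_lines :: "'a::field set \<Rightarrow> 'a set set" where
  "starred_lines K = {l \<in> affine_lines K. 0 \<notin> l}"

definition sigma :: "'a::field \<Rightarrow> 'a \<Rightarrow> 'a" where
  "sigma \<xi> x = \<xi> * x"

definition sigma_line :: "'a::field \<Rightarrow> 'a set \<Rightarrow> 'a set" where
  "sigma_line \<xi> l = sigma \<xi> ` l"

text \<open>The \<open>m\<close>-th member of the \<open>i\<close>-th orbit under \<open>\<langle>\<sigma>\<^sup>t\<rangle>\<close>; the base point is \<open>P\<^sub>0 = \<xi>\<^sup>0 = 1\<close>.\<close>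

definition orbit_point :: "'a::field \<Rightarrow> nat \<Rightarrow> nat \<Rightarrow> nat \<Rightarrow> 'a" where
  "orbit_point \<xi> t i m = (sigma \<xi> ^^ (i + m * t)) 1"

definition orbit_line :: "'a::field \<Rightarrow> 'a set \<Rightarrow> nat \<Rightarrow> nat \<Rightarrow> nat \<Rightarrow> 'a set" where
  "orbit_line \<xi> l0 t i m = (sigma_line \<xi> ^^ (i + m * t)) l0"

definition point_orbit :: "'a::field \<Rightarrow> nat \<Rightarrow> nat \<Rightarrow> nat \<Rightarrow> 'a set" where
  "point_orbit \<xi> t d i = orbit_point \<xi> t i ` {..<d}"

text \<open>Rows are lines and columns are points, listed orbit by orbit: index \<open>i * d + m\<close> with
  \<open>m < d\<close> stands for the \<open>m\<close>-th member of the \<open>i\<close>-th orbit.\<close>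

definition incidence_matrix :: "'a::field \<Rightarrow> 'a set \<Rightarrow> nat \<Rightarrow> nat \<Rightarrow> nat mat" where
  "incidence_matrix \<xi> l0 t d = mat (t * d) (t * d)
     (\<lambda>(r, c). if orbit_point \<xi> t (c div d) (c mod d) \<in> orbit_line \<xi> l0 t (r div d) (r mod d)
               then 1 else 0)"

definition block :: "nat \<Rightarrow> nat mat \<Rightarrow> nat \<Rightarrow> nat \<Rightarrow> nat mat" where
  "block d A i j = mat d d (\<lambda>(m, n). A $$ (i * d + m, j * d + n))"

text \<open>Each row is the cyclic shift, one place to the right, of the row above it.\<close>

definition circulant :: "nat mat \<Rightarrow> bool" where
  "circulant C \<longleftrightarrow> square_mat C \<and>
     (\<forall>m < dim_row C. \<forall>n < dim_row C.
        C $$ (Suc m mod dim_row C, Suc n mod dim_row C) = C $$ (m, n))"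

definition has_weight :: "nat mat \<Rightarrow> nat \<Rightarrow> bool" where
  "has_weight C k \<longleftrightarrow> (\<forall>m < dim_row C. card {n. n < dim_col C \<and> C $$ (m, n) = 1} = k)"

text \<open>\<open>A\<close> is a \<open>t \<times> t\<close> array of circulant \<open>d \<times> d\<close> blocks, and the block weights
  \<open>w\<^bsub>(j - i) mod t\<^esub>\<close> form a circulant pattern themselves
  (\<open>t\<close> is added to \<open>j\<close> to avoid truncated subtraction).\<close>

definition block_double_circulant :: "nat \<Rightarrow> nat \<Rightarrow> nat mat \<Rightarrow> (nat \<Rightarrow> nat) \<Rightarrow> bool" where
  "block_double_circulant t d A w \<longleftrightarrow> A \<in> carrier_mat (t * d) (t * d) \<and>
     (\<forall>i < t. \<forall>j < t. circulant (block d A i j) \<and>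
        has_weight (block d A i j) (w ((j + t - i) mod t)))"

end

theory Submission
  imports Defs "HOL-Number_Theory.Residues"
begin

text \<open>Write \<open>q = s\<^sup>2\<close>, let \<open>Fs\<close> be the subfield of order \<open>s\<close> and let \<open>g = \<xi>\<^bsup>q+1\<^esup>\<close>, a
  primitive element of \<open>K\<close>. The number \<open>q + 1 = s\<^sup>2 + 1\<close> is even, so \<open>\<delta> = \<xi>\<^bsup>(q+1)/2\<^esup>\<close> is a square root of the nonsquare
  \<open>g\<close> of \<open>K\<close>, and \<open>\<delta>\<^bsup>q\<^esup> = -\<delta>\<close>. The line is \<open>{1 + c\<delta> | c \<in> K}\<close>.

  The weights for the finest partition, \<open>t = s + 1\<close>, come from the norm \<open>x \<mapsto> x\<^bsup>q+1\<^esup>\<close> to \<open>K\<close>: it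
  sends \<open>\<xi>\<^bsup>i\<^esup>\<close> to \<open>g\<^bsup>i\<^esup>\<close>, and the nonzero elements of \<open>Fs\<close> are the powers of \<open>g\<^bsup>s+1\<^esup>\<close>, so the orbit of a point
  is determined by the coset of \<open>Fs\<^sup>*\<close> in \<open>K\<^sup>*\<close> that contains its norm. As
  \<open>1 + c\<delta>\<close> has norm \<open>1 - g c\<^sup>2\<close>, the weight \<open>w\<^sub>u\<close> counts the \<open>c \<in> K\<close> with
  \<open>1 - g c\<^sup>2 \<in> g\<^bsup>u\<^esup> Fs\<^sup>*\<close> (\<open>fine_weight_norm\<close>).

  Because \<open>s + 1\<close> is even, a coset \<open>g\<^bsup>v\<^esup> Fs\<^sup>*\<close> consists of squares of \<open>K\<close> for \<open>v\<close> even and of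
  nonsquares for \<open>v\<close> odd, and \<open>g c\<^sup>2 = y\<close> has two solutions or none accordingly
  (\<open>card_nonsquare_fibre\<close>). For \<open>u = 0\<close> the element \<open>g c\<^sup>2\<close> lies in \<open>Fs\<close> and is
  therefore a square of \<open>K\<close>, which forces \<open>c = 0\<close>. For \<open>0 < u \<le> s\<close> one counts the
  \<open>a \<in> Fs\<^sup>*\<close> for which \<open>1 - a g\<^bsup>u\<^esup>\<close> is a nonsquare. Now \<open>K\<close> is a plane over \<open>Fs\<close> with basis
  \<open>1, g\<^bsup>u\<^esup>\<close>, and the cosets of \<open>Fs\<^sup>*\<close> are its \<open>s + 1\<close> points at infinity: the elements
  \<open>1 - a g\<^bsup>u\<^esup>\<close> meet each coset exactly once, except those of \<open>1\<close> and of \<open>g\<^bsup>u\<^esup>\<close>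
  (\<open>pencil_coset_index_bij\<close>). Of the \<open>(s + 1)/2\<close> odd cosets all are met if \<open>u\<close> is even, and all
  but one if \<open>u\<close> is odd, which gives \<open>w\<^sub>u = s + 1\<close> and \<open>w\<^sub>u = s - 1\<close> (\<open>fine_weight_pos\<close>).

  For a divisor \<open>t\<close> of \<open>s + 1\<close> the orbits merge along residue classes modulo \<open>t\<close>, and the weights add
  up. The block structure of the matrix holds for any set of points, since incidence of
  \<open>\<sigma>\<^bsup>a\<^esup>(\<ell>\<^sub>0)\<close> and \<open>\<xi>\<^bsup>b\<^esup>\<close> depends on \<open>b - a\<close> only.\<close>

section \<open>Discrete logarithms in a finite field\<close>

text \<open>Multiplication by \<open>x\<close> permutes \<open>S\<close>, so it leaves the product of all elements unchanged. This
  serves both for the multiplicative group of the whole field and for that of a subfield given as a subset.\<close>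

lemma power_card_eq_1_of_mult_closed:
  fixes S :: "'a::field set"
  assumes fin: "finite S" and nz: "0 \<notin> S" and closed: "\<And>x y. x \<in> S \<Longrightarrow> y \<in> S \<Longrightarrow> x * y \<in> S"
    and x: "x \<in> S"
  shows "x ^ card S = 1"
proof -
  have inj: "inj_on ((*) x) S" using x nz by (auto simp: inj_on_def)
  have "(*) x ` S \<subseteq> S" using closed x by auto
  hence "(*) x ` S = S" using fin inj by (simp add: endo_inj_surj)
  hence "prod id S = prod id ((*) x ` S)" by simp
  also have "\<dots> = (\<Prod>y\<in>S. x * y)" using inj by (simp add: prod.reindex)
  also have "\<dots> = x ^ card S * prod id S" by (simp add: prod.distrib)
  finally have "x ^ card S * prod id S = 1 * prod id S" by simp
  moreover have "prod id S \<noteq> 0" using fin nz by (auto simp: prod_zero_iff)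
  ultimately show ?thesis by (metis mult_right_cancel)
qed

lemma primitive_element_nonzero:
  assumes "primitive_element \<xi>" shows "\<xi> \<noteq> (0::'a::field)"
proof -
  have "\<xi> ^ 1 \<in> - {0}" using assms unfolding primitive_element_def by blast
  thus ?thesis by simp
qed

lemma primitive_power_eq_iff:
  fixes \<xi> :: "'a::{field,finite}"
  assumes prim: "primitive_element \<xi>"
  shows "\<xi> ^ i = \<xi> ^ j \<longleftrightarrow> i mod (CARD('a) - 1) = j mod (CARD('a) - 1)"
proof -
  define N where "N = CARD('a) - 1"
  have cardN: "card (- {0::'a}) = N" by (simp add: N_def card_Diff_singleton Compl_eq_Diff_UNIV)
  have N0: "N > 0" using cardN card_gt_0_iff[of "- {0::'a}"]
    by (metis ComplI finite_code one_neq_zero singletonD empty_iff)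
  have one: "\<xi> ^ N = 1"
  proof -
    have "\<xi> ^ card (- {0::'a}) = 1"
      by (rule power_card_eq_1_of_mult_closed) (use primitive_element_nonzero[OF prim] in simp_all)
    thus ?thesis by (simp only: cardN)
  qed
  have red: "\<xi> ^ i = \<xi> ^ (i mod N)" for i
    by (metis (no_types) div_mult_mod_eq mult.commute mult_1 one power_add power_mult power_one)
  have "(\<lambda>i. \<xi> ^ i) ` {..<N} = - {0}"
  proof -
    have "(\<lambda>i. \<xi> ^ i) ` {..<N} = range (\<lambda>i. \<xi> ^ i)"
      using red N0 by (auto simp: image_iff) (metis lessThan_iff mod_less_divisor)
    thus ?thesis using prim by (simp add: primitive_element_def)
  qed
  hence "inj_on (\<lambda>i. \<xi> ^ i) {..<N}" using cardN by (intro eq_card_imp_inj_on) auto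
  hence "\<xi> ^ (i mod N) = \<xi> ^ (j mod N) \<longleftrightarrow> i mod N = j mod N"
    using N0 by (auto simp: inj_on_def)
  thus ?thesis using red by (metis N_def)
qed

text \<open>Only determined up to multiples of the order of \<open>\<xi>\<close>; it is therefore used modulo divisors of that order, and
  its value at \<open>0\<close> has no meaning.\<close>

definition dlog :: "'a::field \<Rightarrow> 'a \<Rightarrow> nat" where
  "dlog \<xi> x = (SOME i. \<xi> ^ i = x)"

lemma power_dlog:
  assumes "primitive_element \<xi>" "x \<noteq> 0" shows "\<xi> ^ dlog \<xi> x = x"
proof -
  have "\<exists>i. \<xi> ^ i = x" using assms unfolding primitive_element_def
    by (metis ComplI rangeE singletonD)
  thus ?thesis unfolding dlog_def by (rule someI_ex)
qed

lemma dlog_power_mod: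
  fixes \<xi> :: "'a::{field,finite}"
  assumes "primitive_element \<xi>" "m dvd CARD('a) - 1"
  shows "dlog \<xi> (\<xi> ^ i) mod m = i mod m"
proof -
  have "\<xi> ^ dlog \<xi> (\<xi> ^ i) = \<xi> ^ i"
    using assms primitive_element_nonzero by (intro power_dlog) auto
  hence "dlog \<xi> (\<xi> ^ i) mod (CARD('a) - 1) = i mod (CARD('a) - 1)"
    using primitive_power_eq_iff[OF assms(1)] by blast
  thus ?thesis using assms(2) by (metis mod_mod_cancel)
qed

section \<open>Orbits and the block double-circulant matrix\<close>

lemma orbit_point_eq: "orbit_point \<xi> t i m = \<xi> ^ (i + m * t)"
proof -
  have "(sigma \<xi> ^^ n) 1 = \<xi> ^ n" for n by (induction n) (simp_all add: sigma_def)
  thus ?thesis by (simp only: orbit_point_def)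
qed

lemma mem_orbit_line_iff:
  assumes "\<xi> \<noteq> 0"
  shows "x \<in> orbit_line \<xi> l t i m \<longleftrightarrow> x / \<xi> ^ (i + m * t) \<in> l"
proof -
  have "(sigma_line \<xi> ^^ n) l = {x. x / \<xi> ^ n \<in> l}" for n
  proof (induction n)
    case (Suc n)
    have "(sigma_line \<xi> ^^ Suc n) l = (*) \<xi> ` {x. x / \<xi> ^ n \<in> l}"
      by (simp add: Suc.IH sigma_line_def sigma_def[abs_def])
    also have "\<dots> = {x. x / \<xi> ^ Suc n \<in> l}"
    proof (intro equalityI subsetI)
      fix x assume "x \<in> {x. x / \<xi> ^ Suc n \<in> l}"
      hence "x / \<xi> \<in> {x. x / \<xi> ^ n \<in> l}" by simp
      thus "x \<in> (*) \<xi> ` {x. x / \<xi> ^ n \<in> l}"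
        using assms by (intro image_eqI[of _ _ "x / \<xi>"]) simp_all
    qed (use assms in auto)
    finally show ?case .
  qed simp
  thus ?thesis by (simp add: orbit_line_def)
qed

context
  fixes \<xi> :: "'a::{field,finite}" and t d :: nat
  assumes prim: "primitive_element \<xi>" and td: "t * d = CARD('a) - 1" and d_pos: "0 < d"
begin

text \<open>Orbit positions are cyclic: \<open>\<xi>\<^bsup>t\<^esup>\<close> has order \<open>d\<close>.\<close>

lemma power_mod_d: "\<xi> ^ (a + (m mod d) * t) = \<xi> ^ (a + m * t)"
proof -
  have "(m mod d) * t mod (t * d) = m * t mod (t * d)"
    by (metis mod_mod_trivial mult.commute mult_mod_right)
  thus ?thesis unfolding primitive_power_eq_iff[OF prim] td[symmetric] by (metis mod_add_right_eq)
qed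

lemma inj_on_orbit:
  assumes "0 < t" shows "inj_on (\<lambda>m. \<xi> ^ (a + m * t)) {..<d}"
proof (rule inj_onI)
  fix m n assume m: "m \<in> {..<d}" and n: "n \<in> {..<d}" and eq: "\<xi> ^ (a + m * t) = \<xi> ^ (a + n * t)"
  have "\<xi> ^ (m * t) = \<xi> ^ (n * t)"
    using eq primitive_element_nonzero[OF prim] by (simp add: power_add)
  hence "t * m mod (t * d) = t * n mod (t * d)"
    unfolding primitive_power_eq_iff[OF prim] td[symmetric] by (simp only: mult.commute)
  hence "t * (m mod d) = t * (n mod d)" unfolding mult_mod_right .
  thus "m = n" using m n assms by simp
qed

lemma point_orbit_eq:
  assumes "u < t"
  shows "point_orbit \<xi> t d u = {x. x \<noteq> 0 \<and> dlog \<xi> x mod t = u}"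
proof (intro equalityI subsetI)
  fix x assume "x \<in> point_orbit \<xi> t d u"
  then obtain m where m: "x = \<xi> ^ (u + m * t)" by (auto simp: point_orbit_def orbit_point_eq)
  have "dlog \<xi> x mod t = (u + m * t) mod t"
    unfolding m by (rule dlog_power_mod[OF prim]) (simp only: td[symmetric] dvd_triv_left)
  thus "x \<in> {x. x \<noteq> 0 \<and> dlog \<xi> x mod t = u}"
    using assms primitive_element_nonzero[OF prim] by (simp add: m)
next
  fix x assume x: "x \<in> {x. x \<noteq> 0 \<and> dlog \<xi> x mod t = u}"
  define m where "m = dlog \<xi> x div t"
  have "dlog \<xi> x = u + m * t" using x mod_div_mult_eq[of "dlog \<xi> x" t] by (simp add: m_def)
  hence "x = \<xi> ^ (u + m * t)" using power_dlog[OF prim, of x] x by simp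
  hence "x = \<xi> ^ (u + (m mod d) * t)" by (simp only: power_mod_d)
  moreover have "m mod d \<in> {..<d}" using d_pos by simp
  ultimately show "x \<in> point_orbit \<xi> t d u" unfolding point_orbit_def orbit_point_eq by (rule image_eqI)
qed

lemma block_incidence_matrix:
  assumes "i < t" "j < t" "m < d" "n < d"
  shows "block d (incidence_matrix \<xi> l t d) i j $$ (m, n) =
    (if \<xi> ^ (j + n * t) / \<xi> ^ (i + m * t) \<in> l then 1 else 0)"
proof -
  have lt: "a * d + b < t * d" if "a < t" "b < d" for a b
  proof -
    have "a * d + b < Suc a * d" using that by simp
    also have "\<dots> \<le> t * d" using that by (intro mult_le_mono1) simp
    finally show ?thesis .
  qed
  show ?thesis using assms lt[OF assms(1,3)] lt[OF assms(2,4)]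
    by (simp add: block_def incidence_matrix_def orbit_point_eq
        mem_orbit_line_iff[OF primitive_element_nonzero[OF prim]])
qed

text \<open>The points of the \<open>j\<close>-th orbit, pulled back by the power of \<open>\<sigma>\<close> that carries \<open>\<ell>\<^sub>0\<close> to the \<open>m\<close>-th line
  of the \<open>i\<close>-th orbit, run through the orbit with index \<open>j - i\<close>. This makes each row weight of a block an
  intersection number of \<open>\<ell>\<^sub>0\<close> itself.\<close>

lemma translated_orbit:
  assumes "i < t" "j < t"
  shows "(\<lambda>n. \<xi> ^ (j + n * t) / \<xi> ^ (i + m * t)) ` {..<d} = point_orbit \<xi> t d ((j + t - i) mod t)"
    (is "?f ` _ = ?O")
    and "inj_on (\<lambda>n. \<xi> ^ (j + n * t) / \<xi> ^ (i + m * t)) {..<d}"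
proof -
  have t: "0 < t" using assms by simp
  have nz: "\<xi> \<noteq> 0" by (rule primitive_element_nonzero[OF prim])
  show inj: "inj_on ?f {..<d}"
    using inj_on_orbit[OF t, of j] nz by (simp add: inj_on_def)
  have sub: "?f ` {..<d} \<subseteq> ?O"
  proof (rule image_subsetI)
    fix n
    define x where "x = ?f n"
    have x0: "x \<noteq> 0" using nz by (simp add: x_def)
    have "\<xi> ^ (dlog \<xi> x + (i + m * t)) = \<xi> ^ (j + n * t)"
      unfolding power_add[of _ "dlog \<xi> x"] power_dlog[OF prim x0] using nz by (simp add: x_def)
    hence "(dlog \<xi> x + (i + m * t)) mod t = (j + n * t) mod t"
      unfolding primitive_power_eq_iff[OF prim] td[symmetric] by (metis mod_mult_right_eq mod_mod_cancel dvd_triv_left)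
    hence "[dlog \<xi> x + i = j] (mod t)" by (simp add: cong_def flip: add.assoc)
    hence "[dlog \<xi> x + i + (t - i) = j + (t - i)] (mod t)" by (intro cong_add cong_refl)
    hence "dlog \<xi> x mod t = (j + t - i) mod t" using assms by (simp add: cong_def)
    thus "?f n \<in> ?O" using x0 t unfolding x_def[symmetric] by (simp add: point_orbit_eq)
  qed
  have "card ?O = card (?f ` {..<d})"
    unfolding point_orbit_def orbit_point_eq[abs_def] card_image[OF inj] card_image[OF inj_on_orbit[OF t]] ..
  thus "?f ` {..<d} = ?O" by (intro card_subset_eq sub) simp_all
qed

text \<open>Moving one place down and to the right multiplies line and point by \<open>\<xi>\<^bsup>t\<^esup>\<close>, which preserves incidence.\<close>

lemma block_double_circulant_incidence:
  "block_double_circulant t d (incidence_matrix \<xi> l t d) (\<lambda>u. card (l \<inter> point_orbit \<xi> t d u))"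
  unfolding block_double_circulant_def
proof (intro conjI allI impI)
  show "incidence_matrix \<xi> l t d \<in> carrier_mat (t * d) (t * d)" by (simp add: incidence_matrix_def)
next
  fix i j assume ij: "i < t" "j < t"
  let ?C = "block d (incidence_matrix \<xi> l t d) i j"
  have dim: "dim_row ?C = d" "dim_col ?C = d" by (simp_all add: block_def)
  note entry = block_incidence_matrix[OF ij]
  show "circulant ?C"
    unfolding circulant_def dim square_mat.simps
  proof (intro conjI allI impI refl)
    fix m n assume mn: "m < d" "n < d"
    have "\<xi> ^ (j + (Suc n mod d) * t) / \<xi> ^ (i + (Suc m mod d) * t) = \<xi> ^ (j + n * t) / \<xi> ^ (i + m * t)"
      unfolding power_mod_d using primitive_element_nonzero[OF prim] by (simp add: power_add)
    moreover have "Suc m mod d < d" "Suc n mod d < d" using d_pos by simp_all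
    ultimately show "?C $$ (Suc m mod d, Suc n mod d) = ?C $$ (m, n)" using mn by (simp only: entry)
  qed
  show "has_weight ?C (card (l \<inter> point_orbit \<xi> t d ((j + t - i) mod t)))"
    unfolding has_weight_def dim
  proof (intro allI impI)
    fix m assume m: "m < d"
    let ?f = "\<lambda>n. \<xi> ^ (j + n * t) / \<xi> ^ (i + m * t)"
    have image_filter: "f ` {n \<in> A. f n \<in> l} = l \<inter> f ` A" for f :: "nat \<Rightarrow> 'a" and A
      by auto
    have "{n. n < d \<and> ?C $$ (m, n) = 1} = {n \<in> {..<d}. ?f n \<in> l}"
      using m by (auto simp: entry split: if_split_asm)
    moreover have "?f ` {n \<in> {..<d}. ?f n \<in> l} = l \<inter> point_orbit \<xi> t d ((j + t - i) mod t)"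
      unfolding translated_orbit(1)[OF ij, of m, symmetric] by (rule image_filter)
    moreover have "inj_on ?f {n \<in> {..<d}. ?f n \<in> l}"
      by (rule inj_on_subset[OF translated_orbit(2)[OF ij, of m]]) (rule Collect_restrict)
    ultimately show "card {n. n < d \<and> ?C $$ (m, n) = 1} = card (l \<inter> point_orbit \<xi> t d ((j + t - i) mod t))"
      by (simp only: card_image[symmetric])
  qed
qed

end

section \<open>Subfields of a field whose order is a fourth power\<close>

text \<open>The argument lives in a tower of three fields: the subfield of order \<open>s\<close>, the field \<open>K\<close> of order
  \<open>s\<^sup>2\<close>, and the plane, of order \<open>(s\<^sup>2)\<^sup>2\<close>.\<close>

locale fourth_power_field =
  fixes K :: "'a::{field,finite} set" and \<xi> :: 'a and s :: nat
  assumes primepow_s2: "primepow (s\<^sup>2)" and odd_s: "odd s"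
    and card_UNIV: "CARD('a) = (s\<^sup>2)\<^sup>2"
    and subfield: "is_subfield K" and card_K: "card K = s\<^sup>2"
    and prim: "primitive_element \<xi>"
begin

lemma s_gt_1: "s > 1"
proof -
  have "s \<noteq> 0" "s \<noteq> 1" using primepow_s2 odd_s by (auto intro: Nat.gr0I)
  thus ?thesis by linarith
qed

lemma s2_gt_1: "s\<^sup>2 > 1"
  using s_gt_1 by (intro one_less_power) auto

text \<open>The characteristic divides the order of the field, a power of the prime of which \<open>s\<close> is a
  power.\<close>

lemma frobenius: "((x::'a) + y) ^ s = x ^ s + y ^ s"
proof -
  obtain p n where pn: "prime p" "s = p ^ n"
    using primepow_s2 s_gt_1 primepow_power_iff_nat[of s 2] by (auto simp: primepow_def)
  have "CHAR('a) dvd p ^ (n * 2 * 2)"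
    using CHAR_dvd_CARD[where 'a='a] unfolding card_UNIV pn power_mult .
  moreover have pc: "prime CHAR('a)"
    using finite_imp_CHAR_pos[where 'a='a] prime_CHAR_semidom[where 'a='a] by simp
  ultimately have "CHAR('a) = p"
    using pn(1) by (meson prime_dvd_power primes_dvd_imp_eq)
  thus ?thesis using freshmans_dream'[of s n x y] pn pc by simp
qed

lemma frobenius_diff: "((x::'a) - y) ^ s = x ^ s - y ^ s"
  using frobenius[of "x - y" y] by (simp add: algebra_simps)

text \<open>A primitive element of \<open>K\<close>, as \<open>units_K\<close> shows.\<close>

definition g where "g = \<xi> ^ (s\<^sup>2 + 1)"

lemma g_nonzero [simp]: "g \<noteq> 0"
  by (simp add: g_def primitive_element_nonzero[OF prim])

lemma order_factor: "CARD('a) - 1 = (s\<^sup>2 + 1) * (s\<^sup>2 - 1)"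
  by (simp add: card_UNIV power2_eq_square algebra_simps diff_mult_distrib2)

lemma s2_factor: "s\<^sup>2 - 1 = (s + 1) * (s - 1)"
  using s_gt_1 by (simp add: power2_eq_square algebra_simps diff_mult_distrib2)

lemma g_power_eq_iff: "g ^ i = g ^ j \<longleftrightarrow> i mod (s\<^sup>2 - 1) = j mod (s\<^sup>2 - 1)"
proof -
  have "g ^ i = g ^ j \<longleftrightarrow> ((s\<^sup>2 + 1) * i) mod ((s\<^sup>2 + 1) * (s\<^sup>2 - 1)) =
      ((s\<^sup>2 + 1) * j) mod ((s\<^sup>2 + 1) * (s\<^sup>2 - 1))"
    unfolding g_def power_mult[symmetric] primitive_power_eq_iff[OF prim] order_factor ..
  thus ?thesis by (simp only: mult_mod_right[symmetric] mult_cancel1) simp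
qed

lemma g_power_eq_1_iff: "g ^ i = 1 \<longleftrightarrow> (s\<^sup>2 - 1) dvd i"
  using g_power_eq_iff[of i 0] by (simp add: dvd_eq_mod_eq_0)

text \<open>By Fermat, the nonzero elements of \<open>K\<close> satisfy \<open>x ^ (s\<^sup>2 - 1) = 1\<close>; the solutions of this equation
  are powers of \<open>g\<close>, and there are no more than \<open>s\<^sup>2 - 1\<close> of those, as many as \<open>K\<close> has nonzero elements. So all three sets agree.\<close>

lemma units_K: "K - {0} = range (\<lambda>i. g ^ i)"
  and K_iff: "x \<in> K \<longleftrightarrow> x ^ s\<^sup>2 = x"
proof -
  have zero: "0 \<in> K" and mult: "\<And>x y. x \<in> K \<Longrightarrow> y \<in> K \<Longrightarrow> x * y \<in> K"
    using subfield by (auto simp: is_subfield_def)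
  have cardU: "card (K - {0}) = s\<^sup>2 - 1" using zero card_K by simp
  have log: "\<exists>j < s\<^sup>2 - 1. x = g ^ j" if x: "x \<noteq> 0" "x ^ (s\<^sup>2 - 1) = 1" for x
  proof -
    obtain i where i: "x = \<xi> ^ i" using power_dlog[OF prim x(1), symmetric] ..
    have "\<xi> ^ (i * (s\<^sup>2 - 1)) = \<xi> ^ 0" using x(2) i by (simp add: power_mult)
    hence "(s\<^sup>2 + 1) * (s\<^sup>2 - 1) dvd i * (s\<^sup>2 - 1)"
      unfolding primitive_power_eq_iff[OF prim] order_factor by (simp add: dvd_eq_mod_eq_0)
    hence "s\<^sup>2 + 1 dvd i" using s2_gt_1 by (simp only: dvd_times_right_cancel_iff)
    then obtain k where "i = (s\<^sup>2 + 1) * k" by (rule dvdE)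
    hence "x = g ^ k" using i by (simp only: g_def power_mult)
    hence "x = g ^ (k mod (s\<^sup>2 - 1))" using g_power_eq_iff by simp
    thus ?thesis using s2_gt_1 by (intro exI[of _ "k mod (s\<^sup>2 - 1)"]) simp
  qed
  have fermat: "x ^ (s\<^sup>2 - 1) = 1" if "x \<in> K - {0}" for x
    unfolding cardU[symmetric] using that mult by (intro power_card_eq_1_of_mult_closed) auto
  have "K - {0} \<subseteq> (\<lambda>i. g ^ i) ` {..<s\<^sup>2 - 1}" using log fermat by fastforce
  moreover have "card ((\<lambda>i. g ^ i) ` {..<s\<^sup>2 - 1}) \<le> card (K - {0})"
    using card_image_le[of "{..<s\<^sup>2 - 1}" "\<lambda>i. g ^ i"] cardU by simp
  ultimately have eq: "K - {0} = (\<lambda>i. g ^ i) ` {..<s\<^sup>2 - 1}"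
    by (intro card_seteq) auto
  also have "\<dots> = range (\<lambda>i. g ^ i)"
  proof (intro equalityI subsetI)
    fix y assume "y \<in> range (\<lambda>i. g ^ i)"
    then obtain i where "y = g ^ i" by auto
    hence "y = g ^ (i mod (s\<^sup>2 - 1))" using g_power_eq_iff by simp
    thus "y \<in> (\<lambda>i. g ^ i) ` {..<s\<^sup>2 - 1}" using s2_gt_1 by auto
  qed auto
  finally show "K - {0} = range (\<lambda>i. g ^ i)" .
  have pw: "x ^ s\<^sup>2 = x * x ^ (s\<^sup>2 - 1)"
    using power_Suc[of x "s\<^sup>2 - 1"] s2_gt_1 by (simp only: Suc_diff_1 less_trans[OF zero_less_one])
  show "x \<in> K \<longleftrightarrow> x ^ s\<^sup>2 = x"
  proof (cases "x = 0")
    case True thus ?thesis using zero s_gt_1 by simp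
  next
    case False
    hence "x ^ s\<^sup>2 = x \<longleftrightarrow> x ^ (s\<^sup>2 - 1) = 1" using pw by simp
    moreover have "x \<in> K \<longleftrightarrow> x ^ (s\<^sup>2 - 1) = 1"
    proof
      assume "x \<in> K" thus "x ^ (s\<^sup>2 - 1) = 1" using False by (intro fermat) simp
    next
      assume "x ^ (s\<^sup>2 - 1) = 1"
      then obtain j where "j < s\<^sup>2 - 1" "x = g ^ j" using log[OF False] by auto
      hence "x \<in> K - {0}" unfolding eq by simp
      thus "x \<in> K" by simp
    qed
    ultimately show ?thesis by simp
  qed
qed

lemma K_mult: "x \<in> K \<Longrightarrow> y \<in> K \<Longrightarrow> x * y \<in> K"
  and K_diff: "x \<in> K \<Longrightarrow> y \<in> K \<Longrightarrow> x - y \<in> K"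
  and zero_in_K: "0 \<in> K" and one_in_K: "1 \<in> K"
  using subfield by (simp_all add: is_subfield_def)

lemma g_in_K: "g \<in> K"
proof -
  have "g ^ 1 \<in> K - {0}" unfolding units_K by (rule rangeI)
  thus ?thesis by simp
qed

text \<open>The subfield of order \<open>s\<close>, as the fixed points of the Frobenius power \<open>x \<mapsto> x ^ s\<close>.\<close>

definition Fs where "Fs = {x::'a. x ^ s = x}"

lemma g_power_in_Fs_iff: "g ^ i \<in> Fs \<longleftrightarrow> (s + 1) dvd i"
proof -
  have "g ^ i \<in> Fs \<longleftrightarrow> g ^ i * g ^ (i * (s - 1)) = g ^ i"
  proof -
    have "(g ^ i) ^ s = g ^ (i + i * (s - 1))"
      using s_gt_1 by (simp add: power_mult[symmetric] algebra_simps)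
    thus ?thesis by (simp add: Fs_def power_add)
  qed
  also have "\<dots> \<longleftrightarrow> g ^ (i * (s - 1)) = 1" by simp
  also have "\<dots> \<longleftrightarrow> (s + 1) dvd i"
    unfolding g_power_eq_1_iff s2_factor using s_gt_1 by (simp only: dvd_times_right_cancel_iff)
  finally show ?thesis .
qed

lemma zero_in_Fs: "0 \<in> Fs" and one_in_Fs: "1 \<in> Fs"
  using s_gt_1 by (simp_all add: Fs_def)

lemma Fs_mult: "x \<in> Fs \<Longrightarrow> y \<in> Fs \<Longrightarrow> x * y \<in> Fs"
  by (simp add: Fs_def power_mult_distrib)

lemma Fs_divide: "x \<in> Fs \<Longrightarrow> y \<in> Fs \<Longrightarrow> x / y \<in> Fs"
  by (simp add: Fs_def power_divide)

lemma Fs_diff: "x \<in> Fs \<Longrightarrow> y \<in> Fs \<Longrightarrow> x - y \<in> Fs"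
  by (simp add: Fs_def frobenius_diff)

lemma Fs_subset_K: "Fs \<subseteq> K"
  by (auto simp: K_iff Fs_def power2_eq_square power_mult)

lemma card_units_Fs: "card (Fs - {0}) = s - 1"
proof -
  have "Fs - {0} = (\<lambda>j. g ^ ((s + 1) * j)) ` {..<s - 1}" (is "_ = ?R")
  proof (intro equalityI subsetI)
    fix x assume x: "x \<in> Fs - {0}"
    then obtain i where i: "x = g ^ i" using Fs_subset_K units_K by blast
    then obtain j where j: "i = (s + 1) * j" using x g_power_in_Fs_iff by (metis DiffE dvdE)
    have "x = g ^ ((s + 1) * (j mod (s - 1)))"
      unfolding i g_power_eq_iff s2_factor j by (simp only: mult_mod_right[symmetric]) simp
    moreover have "j mod (s - 1) \<in> {..<s - 1}" using s_gt_1 by simp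
    ultimately show "x \<in> ?R" by (rule image_eqI)
  next
    fix x assume "x \<in> ?R"
    then obtain j where j: "x = g ^ ((s + 1) * j)" by (rule imageE)
    have "x \<in> Fs" unfolding j g_power_in_Fs_iff by (rule dvd_triv_left)
    thus "x \<in> Fs - {0}" unfolding j by simp
  qed
  moreover have "inj_on (\<lambda>j. g ^ ((s + 1) * j)) {..<s - 1}"
  proof (rule inj_onI)
    fix i j assume ij: "i \<in> {..<s - 1}" "j \<in> {..<s - 1}" "g ^ ((s + 1) * i) = g ^ ((s + 1) * j)"
    have "(s + 1) * i mod ((s + 1) * (s - 1)) = (s + 1) * j mod ((s + 1) * (s - 1))"
      using ij(3) unfolding g_power_eq_iff s2_factor .
    hence "(s + 1) * (i mod (s - 1)) = (s + 1) * (j mod (s - 1))"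
      unfolding mult_mod_right .
    moreover have "i mod (s - 1) = i" "j mod (s - 1) = j" using ij by auto
    ultimately show "i = j" by (simp only: mult_cancel1) simp
  qed
  ultimately show ?thesis by (simp add: card_image)
qed

section \<open>Cosets of the multiplicative group of the small subfield\<close>

text \<open>Meant for nonzero \<open>y \<in> K\<close>: the \<open>i < s + 1\<close> for which \<open>y\<close> lies in the coset \<open>g ^ i\<close> times \<open>Fs - {0}\<close>.
  Nonzero elements of \<open>K\<close> have a discrete logarithm divisible by \<open>s\<^sup>2 + 1\<close>, and dividing by this number gives the logarithm to
  the base \<open>g\<close>.\<close>

definition coset_index :: "'a \<Rightarrow> nat" where
  "coset_index y = dlog \<xi> y div (s\<^sup>2 + 1) mod (s + 1)"

lemma modulus_dvd: "(s\<^sup>2 + 1) * (s + 1) dvd CARD('a) - 1"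
  unfolding order_factor s2_factor mult.assoc[symmetric] by (rule dvd_triv_left)

lemma coset_index_eq: "coset_index y = (dlog \<xi> y mod ((s\<^sup>2 + 1) * (s + 1))) div (s\<^sup>2 + 1)"
proof -
  have "(n * r + x mod n) div n = r" if "n > 0" for n r x :: nat
    using that by simp
  moreover have "s\<^sup>2 + 1 > 0" by simp
  ultimately show ?thesis by (simp only: coset_index_def mod_mult2_eq)
qed

lemma coset_index_g_power: "coset_index (g ^ i) = i mod (s + 1)"
proof -
  have "dlog \<xi> (g ^ i) mod ((s\<^sup>2 + 1) * (s + 1)) = (s\<^sup>2 + 1) * (i mod (s + 1))"
    unfolding g_def power_mult[symmetric] dlog_power_mod[OF prim modulus_dvd] mult_mod_right ..
  moreover have "n * r div n = r" if "n > 0" for n r :: nat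
    using that by simp
  moreover have "s\<^sup>2 + 1 > 0" by simp
  ultimately show ?thesis unfolding coset_index_eq by (simp only:)
qed

text \<open>The norm of \<open>\<xi> ^ i\<close> is \<open>g ^ i\<close>, so the norm carries the orbits of points for \<open>t = s + 1\<close> to the
  cosets.\<close>

lemma coset_index_norm:
  assumes "x \<noteq> 0" shows "coset_index (x ^ (s\<^sup>2 + 1)) = dlog \<xi> x mod (s + 1)"
proof -
  have "x ^ (s\<^sup>2 + 1) = g ^ dlog \<xi> x"
    using power_dlog[OF prim assms] unfolding g_def by (metis power_mult mult.commute)
  thus ?thesis using coset_index_g_power by simp
qed

lemma coset_index_eq_iff:
  assumes "x \<in> K - {0}" "y \<in> K - {0}"
  shows "coset_index x = coset_index y \<longleftrightarrow> x / y \<in> Fs"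
proof -
  have "x / y \<in> K - {0}" using assms by (simp add: K_iff power_divide)
  then obtain i j where ij: "x / y = g ^ i" "y = g ^ j" using assms units_K by blast
  hence x: "x = g ^ (i + j)" by (simp add: power_add divide_eq_eq)
  have "coset_index x = coset_index y \<longleftrightarrow> (i + j) mod (s + 1) = (0 + j) mod (s + 1)"
    unfolding x ij(2) coset_index_g_power by simp
  also have "\<dots> \<longleftrightarrow> i mod (s + 1) = 0 mod (s + 1)"
    by (metis cong_add_rcancel_nat cong_def)
  also have "\<dots> \<longleftrightarrow> x / y \<in> Fs" unfolding ij(1) g_power_in_Fs_iff by (simp add: dvd_eq_mod_eq_0)
  finally show ?thesis .
qed

lemma coset_index_1: "coset_index 1 = 0"
  using coset_index_g_power[of 0] by simp

lemma coset_index_eq_0_iff: "x \<in> K - {0} \<Longrightarrow> coset_index x = 0 \<longleftrightarrow> x \<in> Fs"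
  using coset_index_eq_iff[of x 1] coset_index_1 one_in_K by simp

lemma coset_index_le: "coset_index x \<le> s"
proof -
  have "coset_index x < s + 1" unfolding coset_index_def by (rule mod_less_divisor) simp
  thus ?thesis by simp
qed

text \<open>Reduction modulo the even number \<open>s + 1\<close> keeps parity, so the coset of an element of \<open>K\<close> shows whether it is a
  square in \<open>K\<close>.\<close>

lemma even_coset_index_g_power: "even (coset_index (g ^ i)) \<longleftrightarrow> even i"
  unfolding coset_index_g_power by (rule dvd_mod_iff) (use odd_s in simp)

section \<open>Norms on the base line\<close>

definition \<delta> where "\<delta> = \<xi> ^ ((s\<^sup>2 + 1) div 2)"

lemma double_half_exponent: "(s\<^sup>2 + 1) div 2 * 2 = s\<^sup>2 + 1"
  by (rule dvd_div_mult_self) (use odd_s in simp)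

lemma delta_square: "\<delta> * \<delta> = g"
  unfolding \<delta>_def g_def power_add[symmetric] mult_2_right[symmetric] double_half_exponent ..

text \<open>The square of \<open>\<delta> ^ (s\<^sup>2 - 1)\<close> is \<open>1\<close>, but the element itself is a power of \<open>\<xi>\<close> whose exponent is half of
  the order of \<open>\<xi>\<close>, so it is not \<open>1\<close>. That \<open>-1\<close> and \<open>1\<close> differ comes with it.\<close>

lemma delta_power: "\<delta> ^ (s\<^sup>2 - 1) = - 1" and minus_one_neq_one: "(- 1 :: 'a) \<noteq> 1"
proof -
  have "\<delta> ^ (s\<^sup>2 - 1) * \<delta> ^ (s\<^sup>2 - 1) = g ^ (s\<^sup>2 - 1)"
    unfolding power_mult_distrib[symmetric] delta_square ..
  also have "\<dots> = 1" unfolding g_power_eq_1_iff by (rule dvd_refl)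
  finally have sq: "\<delta> ^ (s\<^sup>2 - 1) = 1 \<or> \<delta> ^ (s\<^sup>2 - 1) = - 1"
    by (simp only: square_eq_1_iff)
  have ne: "\<delta> ^ (s\<^sup>2 - 1) \<noteq> 1"
  proof
    assume "\<delta> ^ (s\<^sup>2 - 1) = 1"
    hence "\<xi> ^ ((s\<^sup>2 + 1) div 2 * (s\<^sup>2 - 1)) = \<xi> ^ 0" by (simp only: \<delta>_def power_mult power_0)
    hence dv: "(s\<^sup>2 + 1) * (s\<^sup>2 - 1) dvd (s\<^sup>2 + 1) div 2 * (s\<^sup>2 - 1)"
      unfolding primitive_power_eq_iff[OF prim] order_factor by (simp only: mod_0 dvd_eq_mod_eq_0)
    have "s\<^sup>2 - 1 \<noteq> 0" using s2_gt_1 by linarith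
    hence "s\<^sup>2 + 1 dvd (s\<^sup>2 + 1) div 2"
      using dvd_times_right_cancel_iff[THEN iffD1, OF _ dv] by blast
    hence "s\<^sup>2 + 1 \<le> (s\<^sup>2 + 1) div 2" using double_half_exponent by (intro dvd_imp_le) auto
    thus False using double_half_exponent by linarith
  qed
  show "\<delta> ^ (s\<^sup>2 - 1) = - 1" using sq ne by blast
  with ne show "(- 1 :: 'a) \<noteq> 1" by metis
qed

text \<open>The \<open>s\<^sup>2\<close>-power map fixes \<open>K\<close> and negates \<open>\<delta>\<close>, so it conjugates \<open>1 + c * \<delta>\<close> to
  \<open>1 - c * \<delta>\<close>.\<close>

lemma norm_base_point:
  assumes "c \<in> K" shows "(1 + c * \<delta>) ^ (s\<^sup>2 + 1) = 1 - g * c\<^sup>2"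
proof -
  have frob2: "(x + y) ^ s\<^sup>2 = x ^ s\<^sup>2 + y ^ s\<^sup>2" for x y :: 'a
    by (simp only: power2_eq_square power_mult frobenius)
  have "\<delta> ^ s\<^sup>2 = \<delta> * \<delta> ^ (s\<^sup>2 - 1)"
    using power_Suc[of \<delta> "s\<^sup>2 - 1"] s2_gt_1 by (simp only: Suc_diff_1 less_trans[OF zero_less_one])
  hence "\<delta> ^ s\<^sup>2 = - \<delta>" using delta_power by simp
  moreover have "c ^ s\<^sup>2 = c" using assms K_iff by blast
  ultimately have "(1 + c * \<delta>) ^ s\<^sup>2 = 1 - c * \<delta>"
    by (simp add: frob2 power_mult_distrib)
  hence "(1 + c * \<delta>) ^ (s\<^sup>2 + 1) = (1 - c * \<delta>) * (1 + c * \<delta>)" by (simp only: power_add power_one_right)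
  also have "\<dots> = 1 - (\<delta> * \<delta>) * c\<^sup>2" by (simp add: power2_eq_square algebra_simps)
  finally show ?thesis by (simp only: delta_square)
qed

lemma odd_coset_index_nonsquare:
  assumes "c \<in> K - {0}" shows "odd (coset_index (g * c\<^sup>2))"
proof -
  obtain i where "c = g ^ i" using assms units_K by blast
  hence "g * c\<^sup>2 = g ^ (2 * i + 1)" by (simp only: power_add power_one_right power_even_eq mult.commute[of _ g])
  thus ?thesis by (simp only: even_coset_index_g_power) simp
qed

text \<open>The value \<open>0\<close> would give \<open>g * c\<^sup>2\<close>, an element of odd index, the value \<open>1\<close>, whose index is \<open>0\<close>.\<close>

lemma norm_value_in_units:
  assumes "c \<in> K" shows "1 - g * c\<^sup>2 \<in> K - {0}"
proof -
  have "1 - g * c\<^sup>2 \<noteq> 0"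
  proof
    assume "1 - g * c\<^sup>2 = 0"
    hence eq: "g * c\<^sup>2 = 1" by simp
    hence "c \<in> K - {0}" using assms by auto
    hence "odd (coset_index 1)" using odd_coset_index_nonsquare eq by metis
    thus False by (simp add: coset_index_1)
  qed
  thus ?thesis using assms by (simp add: power2_eq_square K_diff K_mult g_in_K one_in_K)
qed

text \<open>If \<open>y = g ^ (2 * j + 1)\<close>, the solutions are \<open>g ^ j\<close> and its negative; if \<open>y\<close> has even index, it differs
  from all \<open>g * c\<^sup>2\<close> with \<open>c \<noteq> 0\<close>, whose index is odd.\<close>

lemma card_nonsquare_fibre:
  assumes "y \<in> K - {0}"
  shows "card {c \<in> K. g * c\<^sup>2 = y} = (if odd (coset_index y) then 2 else 0)"
proof (cases "odd (coset_index y)")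
  case True
  obtain i where i: "y = g ^ i" using assms units_K by blast
  with True have "odd i" using even_coset_index_g_power by simp
  then obtain j where j: "i = 2 * j + 1" by (rule oddE)
  define b where "b = g ^ j"
  have b: "b \<in> K - {0}" unfolding b_def units_K by (rule rangeI)
  hence mb: "- b \<in> K" using K_diff[OF zero_in_K, of b] by simp
  have "y = g * b\<^sup>2" by (simp only: i j b_def power_add power_one_right power_even_eq mult.commute[of _ g])
  hence "{c \<in> K. g * c\<^sup>2 = y} = {c \<in> K. c\<^sup>2 = b\<^sup>2}" by simp
  also have "\<dots> = {b, - b}"
  proof (intro equalityI subsetI)
    fix c assume "c \<in> {c \<in> K. c\<^sup>2 = b\<^sup>2}"
    thus "c \<in> {b, - b}" by (simp add: power2_eq_iff)
  next
    fix c assume "c \<in> {b, - b}"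
    thus "c \<in> {c \<in> K. c\<^sup>2 = b\<^sup>2}" using b mb by (elim insertE) simp_all
  qed
  finally have "{c \<in> K. g * c\<^sup>2 = y} = {b, - b}" .
  moreover have "b \<noteq> - b"
  proof
    assume "b = - b"
    hence "1 * b = - 1 * b" by simp
    hence "(1::'a) = - 1" using b mult_right_cancel[of b] by blast
    thus False using minus_one_neq_one by metis
  qed
  ultimately show ?thesis using True by simp
next
  case False
  have "c \<notin> K" if "g * c\<^sup>2 = y" for c
  proof
    assume "c \<in> K"
    moreover have "c \<noteq> 0"
    proof
      assume "c = 0"
      hence "y = 0" using that by simp
      thus False using assms by simp
    qed
    ultimately have "odd (coset_index (g * c\<^sup>2))" by (intro odd_coset_index_nonsquare) simp
    thus False using False unfolding that by simp
  qed
  hence "{c \<in> K. g * c\<^sup>2 = y} = {}" by blast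
  thus ?thesis using False by simp
qed

text \<open>As \<open>h = g ^ u\<close> lies outside \<open>Fs\<close>, the elements \<open>1\<close> and \<open>h\<close> are linearly independent over \<open>Fs\<close>. So
  \<open>1 - a * h\<close> and \<open>1 - a' * h\<close> are proportional over \<open>Fs\<close> only for \<open>a = a'\<close>, and for \<open>a \<noteq> 0\<close> none of these
  elements is proportional to \<open>1\<close> or to \<open>h\<close>, the elements of index \<open>0\<close> and \<open>u\<close>. Counting makes the injection a bijection: both
  sets have \<open>s - 1\<close> elements.\<close>

lemma pencil_coset_index_bij:
  assumes u: "0 < u" "u \<le> s"
  shows "bij_betw (\<lambda>a. coset_index (1 - a * g ^ u)) (Fs - {0}) ({1..s} - {u})"
    and "a \<in> Fs \<Longrightarrow> 1 - a * g ^ u \<in> K - {0}"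
proof -
  define h where "h = g ^ u"
  have hK: "h \<in> K - {0}" unfolding h_def units_K by (rule rangeI)
  have hk: "h \<notin> Fs" unfolding h_def g_power_in_Fs_iff using u by (auto dest: dvd_imp_le)
  \<comment> \<open>Linear independence in the form in which it is used: an element of \<open>Fs\<close> is a multiple of \<open>h\<close>
    over \<open>Fs\<close> only trivially.\<close>
  have sep: "y = 0" if "x \<in> Fs" "y \<in> Fs" "x = y * h" for x y
    using Fs_divide[OF that(1,2)] that(3) hk by (cases "y = 0") auto
  have index_h: "coset_index h = u" unfolding h_def coset_index_g_power using u by simp
  have unit: "1 - a * h \<in> K - {0}" if "a \<in> Fs" for a
    using sep[OF one_in_Fs that] that hK Fs_subset_K by (auto intro!: K_diff K_mult one_in_K)
  show "a \<in> Fs \<Longrightarrow> 1 - a * g ^ u \<in> K - {0}" using unit unfolding h_def .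
  have inj: "inj_on (\<lambda>a. coset_index (1 - a * h)) (Fs - {0})"
  proof (rule inj_onI)
    fix a a' assume a: "a \<in> Fs - {0}" "a' \<in> Fs - {0}" "coset_index (1 - a * h) = coset_index (1 - a' * h)"
    define b where "b = (1 - a * h) / (1 - a' * h)"
    have bk: "b \<in> Fs" using a unit coset_index_eq_iff unfolding b_def by blast
    have "1 - a' * h \<noteq> 0" using unit a(2) by blast
    hence "1 - a * h = b * (1 - a' * h)" unfolding b_def by simp
    hence eq: "1 - b = (a - b * a') * h" by (simp add: algebra_simps)
    have "a - b * a' = 0" using a bk by (intro sep[OF _ _ eq] Fs_diff Fs_mult one_in_Fs) auto
    with eq show "a = a'" by simp
  qed
  have sub: "(\<lambda>a. coset_index (1 - a * h)) ` (Fs - {0}) \<subseteq> {1..s} - {u}"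
  proof (rule image_subsetI)
    fix a assume a: "a \<in> Fs - {0}"
    have "coset_index (1 - a * h) \<noteq> 0"
    proof
      assume "coset_index (1 - a * h) = 0"
      hence "1 - a * h \<in> Fs" using coset_index_eq_0_iff unit a by blast
      hence "1 - (1 - a * h) \<in> Fs" by (rule Fs_diff[OF one_in_Fs])
      thus False using sep[of "1 - (1 - a * h)" a] a by simp
    qed
    moreover have "coset_index (1 - a * h) \<noteq> u"
    proof
      assume "coset_index (1 - a * h) = u"
      hence "(1 - a * h) / h \<in> Fs" using coset_index_eq_iff[of "1 - a * h" h] index_h unit hK a by simp
      define b where "b = (1 - a * h) / h"
      have bk: "b \<in> Fs" using \<open>(1 - a * h) / h \<in> Fs\<close> by (simp only: b_def)
      have "b * h = 1 - a * h" using hK by (simp add: b_def)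
      hence "1 = (b - (0 - a)) * h" by (simp add: algebra_simps)
      moreover have "b - (0 - a) \<in> Fs" using bk a by (intro Fs_diff zero_in_Fs) auto
      ultimately show False using sep[OF one_in_Fs, of "b - (0 - a)"] by simp
    qed
    ultimately show "coset_index (1 - a * h) \<in> {1..s} - {u}" using coset_index_le[of "1 - a * h"] by simp
  qed
  have "card ({1..s} - {u}) = card (Fs - {0})" using u card_units_Fs by simp
  hence "(\<lambda>a. coset_index (1 - a * h)) ` (Fs - {0}) = {1..s} - {u}"
    using sub card_image[OF inj] by (intro card_subset_eq) auto
  thus "bij_betw (\<lambda>a. coset_index (1 - a * g ^ u)) (Fs - {0}) ({1..s} - {u})"
    using inj by (simp only: bij_betw_def h_def)
qed

section \<open>The weights of the base line\<close>

definition base_line where "base_line = {1 + c * \<delta> | c. c \<in> K}"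

lemma delta_nonzero: "\<delta> \<noteq> 0"
  using delta_square g_nonzero by auto

lemma base_point_nonzero: "c \<in> K \<Longrightarrow> 1 + c * \<delta> \<noteq> 0"
  using norm_base_point[of c] norm_value_in_units[of c] by auto

lemma base_line_starred: "base_line \<in> starred_lines K"
proof -
  have "base_line \<in> affine_lines K"
    unfolding base_line_def affine_lines_def using delta_nonzero by blast
  moreover have "0 \<notin> base_line" unfolding base_line_def using base_point_nonzero by auto
  ultimately show ?thesis by (simp add: starred_lines_def)
qed

text \<open>The weights for \<open>t = s + 1\<close>, from which those for the divisors of \<open>s + 1\<close> are obtained by summation.\<close>

definition fine_weight where
  "fine_weight u = card {x \<in> base_line. dlog \<xi> x mod (s + 1) = u}"

lemma fine_weight_norm: "fine_weight u = card {c \<in> K. coset_index (1 - g * c\<^sup>2) = u}"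
proof -
  have "{x \<in> base_line. dlog \<xi> x mod (s + 1) = u} =
      (\<lambda>c. 1 + c * \<delta>) ` {c \<in> K. coset_index (1 - g * c\<^sup>2) = u}"
  proof -
    have "coset_index (1 - g * c\<^sup>2) = dlog \<xi> (1 + c * \<delta>) mod (s + 1)" if "c \<in> K" for c
      using coset_index_norm[OF base_point_nonzero[OF that]] norm_base_point[OF that] by simp
    thus ?thesis unfolding base_line_def by auto
  qed
  moreover have "inj_on (\<lambda>c. 1 + c * \<delta>) A" for A
    using delta_nonzero by (auto intro: inj_onI)
  ultimately show ?thesis unfolding fine_weight_def by (simp add: card_image)
qed

text \<open>If \<open>1 - g * c\<^sup>2 \<in> Fs\<close>, then \<open>g * c\<^sup>2 \<in> Fs\<close>. Nonzero elements of \<open>Fs\<close> have the even index \<open>0\<close> and are squares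
  in \<open>K\<close>, which \<open>g * c\<^sup>2\<close> is not unless \<open>c = 0\<close>.\<close>

lemma fine_weight_0: "fine_weight 0 = 1"
proof -
  have "{c \<in> K. coset_index (1 - g * c\<^sup>2) = 0} = {0}"
  proof (intro equalityI subsetI)
    fix c assume "c \<in> {c \<in> K. coset_index (1 - g * c\<^sup>2) = 0}"
    hence c: "c \<in> K" "coset_index (1 - g * c\<^sup>2) = 0" by auto
    hence "1 - g * c\<^sup>2 \<in> Fs" using coset_index_eq_0_iff norm_value_in_units by blast
    hence "1 - (1 - g * c\<^sup>2) \<in> Fs" by (rule Fs_diff[OF one_in_Fs])
    hence gk: "g * c\<^sup>2 \<in> Fs" by simp
    have "c = 0"
    proof (rule ccontr)
      assume "c \<noteq> 0"
      hence odd: "odd (coset_index (g * c\<^sup>2))" using c(1) by (intro odd_coset_index_nonsquare) simp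
      have "g * c\<^sup>2 \<in> K - {0}" using gk Fs_subset_K \<open>c \<noteq> 0\<close> by auto
      thus False using coset_index_eq_0_iff gk odd by (metis even_zero)
    qed
    thus "c \<in> {0}" by simp
  qed (simp add: coset_index_1 zero_in_K)
  thus ?thesis by (simp add: fine_weight_norm)
qed

lemma sum_odd_except:
  assumes "odd n" "u \<in> {1..n}"
  shows "(\<Sum>v\<in>{1..n} - {u}. if odd v then 2 else (0::nat)) = (if odd u then n - 1 else n + 1)"
proof -
  have "(\<Sum>v = 1..n. if odd v then 2 else (0::nat)) = (if odd n then n + 1 else n)" for n
    by (induction n) auto
  hence "(\<Sum>v = 1..n. if odd v then 2 else (0::nat)) = n + 1" using assms(1) by simp
  thus ?thesis using assms(2) by (simp add: sum_diff1_nat)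
qed

text \<open>Sorting the \<open>c\<close> by the nonzero \<open>a \<in> Fs\<close> with \<open>1 - g * c\<^sup>2 = a * g ^ u\<close>, each \<open>a\<close> contributes two or none according to the
  parity of the index of \<open>1 - a * g ^ u\<close>, and that index runs through \<open>{1..s} - {u}\<close>.\<close>

lemma fine_weight_pos:
  assumes u: "0 < u" "u \<le> s"
  shows "fine_weight u = (if odd u then s - 1 else s + 1)"
proof -
  let ?F = "\<lambda>a. {c \<in> K. g * c\<^sup>2 = 1 - a * g ^ u}"
  have hK: "g ^ u \<in> K - {0}" unfolding units_K by (rule rangeI)
  have index_h: "coset_index (g ^ u) = u" unfolding coset_index_g_power using u by simp
  have "coset_index (1 - g * c\<^sup>2) = u \<longleftrightarrow> (\<exists>a \<in> Fs - {0}. g * c\<^sup>2 = 1 - a * g ^ u)" if "c \<in> K" for c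
  proof -
    define y where "y = 1 - g * c\<^sup>2"
    have yK: "y \<in> K - {0}" using norm_value_in_units[OF that] by (simp only: y_def)
    have "coset_index y = u \<longleftrightarrow> y / g ^ u \<in> Fs" using coset_index_eq_iff[OF yK hK] index_h by simp
    also have "\<dots> \<longleftrightarrow> (\<exists>a \<in> Fs - {0}. y = a * g ^ u)"
      using yK by (auto simp: field_simps intro!: bexI[of _ "y / g ^ u"])
    also have "\<dots> \<longleftrightarrow> (\<exists>a \<in> Fs - {0}. g * c\<^sup>2 = 1 - a * g ^ u)"
      unfolding y_def by (intro bex_cong refl) (auto simp: algebra_simps)
    finally show ?thesis unfolding y_def .
  qed
  hence "{c \<in> K. coset_index (1 - g * c\<^sup>2) = u} = (\<Union>a \<in> Fs - {0}. ?F a)" by blast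
  hence "fine_weight u = (\<Sum>a \<in> Fs - {0}. card (?F a))"
    unfolding fine_weight_norm by (auto intro!: card_UN_disjoint)
  also have "\<dots> = (\<Sum>a \<in> Fs - {0}. if odd (coset_index (1 - a * g ^ u)) then 2 else 0)"
    using pencil_coset_index_bij(2)[OF u] by (intro sum.cong refl card_nonsquare_fibre) simp
  also have "\<dots> = (\<Sum>v \<in> {1..s} - {u}. if odd v then 2 else 0)"
    using pencil_coset_index_bij(1)[OF u] by (rule sum.reindex_bij_betw)
  also have "\<dots> = (if odd u then s - 1 else s + 1)"
    using odd_s u by (intro sum_odd_except) auto
  finally show ?thesis .
qed

text \<open>A residue class modulo \<open>t\<close> splits into \<open>r\<close> residue classes modulo \<open>s + 1 = t * r\<close>.\<close>

lemma card_base_line_orbit: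
  assumes "s + 1 = t * r" "t * d = CARD('a) - 1" "0 < d" "u < t"
  shows "card (base_line \<inter> point_orbit \<xi> t d u) = (\<Sum>v<r. fine_weight (u + v * t))"
proof -
  let ?A = "\<lambda>v. {x \<in> base_line. dlog \<xi> x mod (s + 1) = u + v * t}"
  have "(\<exists>v<r. e mod (s + 1) = u + v * t) \<longleftrightarrow> e mod t = u" for e
  proof
    assume "\<exists>v<r. e mod (s + 1) = u + v * t"
    then obtain v where "e mod (t * r) = u + v * t" using assms(1) by auto
    hence "e mod (t * r) mod t = u" using assms(4) by simp
    thus "e mod t = u" by (simp add: mod_mod_cancel)
  next
    assume "e mod t = u"
    moreover have "e div t mod r < r" using assms(1) by (intro mod_less_divisor) (cases r; simp)
    ultimately show "\<exists>v<r. e mod (s + 1) = u + v * t"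
      unfolding assms(1) mod_mult2_eq by (intro exI[of _ "e div t mod r"]) simp
  qed
  moreover have "x \<noteq> 0" if "x \<in> base_line" for x
    using that base_line_starred by (auto simp: starred_lines_def)
  ultimately have "base_line \<inter> point_orbit \<xi> t d u = (\<Union>v<r. ?A v)"
    unfolding point_orbit_eq[OF prim assms(2,3,4)] by auto
  also have "card \<dots> = (\<Sum>v<r. card (?A v))" using assms(4) by (intro card_UN_disjoint) auto
  finally show ?thesis by (simp only: fine_weight_def)
qed

end

section \<open>Weights for the divisors of \<open>s + 1\<close>\<close>

theorem theorem3p11:
  fixes K :: "'a::{field,finite} set" and \<xi> :: 'a and q s :: nat
  assumes "primepow q" and "odd q" and "q = s ^ 2"
    and "CARD('a) = q ^ 2"
    and "is_subfield K" and "card K = q"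
    and "primitive_element \<xi>"
  shows "\<exists>l0 \<in> starred_lines K. \<forall>t d. t dvd s + 1 \<longrightarrow> d = (q ^ 2 - 1) div t \<longrightarrow>
    (let w = (\<lambda>u. card (l0 \<inter> point_orbit \<xi> t d u)) in
      block_double_circulant t d (incidence_matrix \<xi> l0 t d) w \<and>
      (t = s + 1 \<longrightarrow>
         w 0 = 1 \<and>
         (\<forall>j\<in>{1..s}. w j = (if odd j then s - 1 else s + 1))) \<and>
      (t = (s + 1) div 2 \<and> s mod 4 = 1 \<longrightarrow>
         w 0 = s \<and>
         (\<forall>j\<in>{1..<t}. w j = 2 * s)) \<and>
      (t = (s + 1) div 2 \<and> s mod 4 = 3 \<longrightarrow>
         w 0 = s + 2 \<and>
         (\<forall>j\<in>{1..<t}. w j = (if odd j then 2 * s - 2 else 2 * s + 2))) \<and>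
      (t = (s + 1) div 4 \<and> s mod 4 = 3 \<longrightarrow>
         (odd t \<longrightarrow> w 0 = 3 * s \<and> (\<forall>j\<in>{1..<t}. w j = 4 * s)) \<and>
         (even t \<longrightarrow> w 0 = 3 * s + 4 \<and>
            (\<forall>j\<in>{1..<t}. w j = (if odd j then 4 * s - 4 else 4 * s + 4)))))"
proof -
  have "odd s" using assms(2,3) by simp
  then interpret fourth_power_field K \<xi> s
    using assms by unfold_locales simp_all
  show ?thesis
  proof (intro bexI[OF _ base_line_starred] allI impI, goal_cases)
    case (1 t d)
    note t = 1(1) and d = 1(2)
    define w where "w u = card (base_line \<inter> point_orbit \<xi> t d u)" for u
    have N: "CARD('a) - 1 = q\<^sup>2 - 1" using assms(4) by simp
    have "s + 1 dvd CARD('a) - 1" using modulus_dvd by (rule dvd_mult_right)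
    hence tN: "t dvd q\<^sup>2 - 1" using t unfolding N by (rule dvd_trans[rotated])
    have td: "t * d = CARD('a) - 1" using tN unfolding N d by (rule dvd_mult_div_cancel)
    have "q\<^sup>2 > 1" using one_less_power[OF s2_gt_1, of 2] by (simp only: assms(3) zero_less_numeral)
    hence d_pos: "0 < d" using td N by (cases d) simp_all
    have count: "w u = (\<Sum>v<r. fine_weight (u + v * t))" if "s + 1 = t * r" "u < t" for u r
      unfolding w_def by (rule card_base_line_orbit[OF that(1) td d_pos that(2)])
    have s1: "s > 1" by (rule s_gt_1)
    have t0: "t > 0" using t by (cases t) auto
    have matrix: "block_double_circulant t d (incidence_matrix \<xi> base_line t d) w"
      unfolding w_def[abs_def] by (rule block_double_circulant_incidence[OF prim td d_pos])
    have full: "t = s + 1 \<longrightarrow> w 0 = 1 \<and> (\<forall>j\<in>{1..s}. w j = (if odd j then s - 1 else s + 1))"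
    proof
      assume ts: "t = s + 1"
      have "w u = fine_weight u" if "u < s + 1" for u
        using count[of 1 u] that unfolding ts by simp
      thus "w 0 = 1 \<and> (\<forall>j\<in>{1..s}. w j = (if odd j then s - 1 else s + 1))"
        using fine_weight_0 fine_weight_pos by simp
    qed
    \<comment> \<open>In a sum over \<open>u + v * t\<close> only the term with \<open>v = 0\<close> can have the exceptional index \<open>0\<close>; the parities of the
      other indices alternate with \<open>v\<close> if \<open>t\<close> is odd and agree if \<open>t\<close> is even.\<close>
    have shifted: "fine_weight (u + v * t) = (if odd (u + v * t) then s - 1 else s + 1)"
      if "s + 1 = t * r" "u < t" "0 < v" "v < r" for u v r
    proof (rule fine_weight_pos)
      show "0 < u + v * t" using t0 that(3) by simp
      have "u + v * t < Suc v * t" using that(2) by simp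
      also have "\<dots> \<le> t * r" using that(4) by (subst mult.commute) (intro mult_le_mono2, simp)
      finally show "u + v * t \<le> s" unfolding that(1)[symmetric] by simp
    qed
    have unshifted: "fine_weight u = (if u = 0 then 1 else if odd u then s - 1 else s + 1)" if "u < t" for u
    proof (cases "u = 0")
      case False
      have "t \<le> s + 1" using t by (rule dvd_imp_le) simp
      thus ?thesis using False that fine_weight_pos[of u] by simp
    qed (simp add: fine_weight_0)
    have two: "w u = (if u = 0 then 1 else if odd u then s - 1 else s + 1) +
        (if odd (u + t) then s - 1 else s + 1)" if r: "s + 1 = t * 2" "u < t" for u
      using count[OF r] shifted[OF r, of 1] unshifted[OF r(2)] by (simp add: numeral_2_eq_2)
    have half1: "t = (s + 1) div 2 \<and> s mod 4 = 1 \<longrightarrow> w 0 = s \<and> (\<forall>j\<in>{1..<t}. w j = 2 * s)"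
    proof
      assume "t = (s + 1) div 2 \<and> s mod 4 = 1"
      hence st: "s + 1 = t * 2" and odd: "odd t" by presburger+
      show "w 0 = s \<and> (\<forall>j\<in>{1..<t}. w j = 2 * s)"
        using two[OF st] odd s1 t0 by (intro conjI ballI) simp_all
    qed
    have half3: "t = (s + 1) div 2 \<and> s mod 4 = 3 \<longrightarrow>
        w 0 = s + 2 \<and> (\<forall>j\<in>{1..<t}. w j = (if odd j then 2 * s - 2 else 2 * s + 2))"
    proof
      assume "t = (s + 1) div 2 \<and> s mod 4 = 3"
      hence st: "s + 1 = t * 2" and even: "even t" by presburger+
      show "w 0 = s + 2 \<and> (\<forall>j\<in>{1..<t}. w j = (if odd j then 2 * s - 2 else 2 * s + 2))"
      proof (intro conjI ballI)
        show "w 0 = s + 2" using two[OF st, of 0] even t0 by simp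
        fix j assume "j \<in> {1..<t}"
        hence "w j = (if odd j then (s - 1) + (s - 1) else (s + 1) + (s + 1))"
          using two[OF st, of j] even by simp
        thus "w j = (if odd j then 2 * s - 2 else 2 * s + 2)" by presburger
      qed
    qed
    have sum4: "(\<Sum>v<4. f v) = f 0 + f 1 + f 2 + f 3" for f :: "nat \<Rightarrow> nat"
      by (simp add: numeral_eq_Suc)
    have four: "w u = (if u = 0 then 1 else if odd u then s - 1 else s + 1) +
        2 * (if odd (u + t) then s - 1 else s + 1) + (if odd u then s - 1 else s + 1)"
      if r: "s + 1 = t * 4" "u < t" for u
    proof -
      have "w u = fine_weight u + fine_weight (u + 1 * t) + fine_weight (u + 2 * t) + fine_weight (u + 3 * t)"
        using count[OF r] unfolding sum4 by (simp only: mult_zero_left add_0_right)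
      moreover have "fine_weight (u + 1 * t) = (if odd (u + t) then s - 1 else s + 1)"
        using shifted[OF r, of 1] by simp
      moreover have "fine_weight (u + 2 * t) = (if odd u then s - 1 else s + 1)"
        using shifted[OF r, of 2] by simp
      moreover have "fine_weight (u + 3 * t) = (if odd (u + t) then s - 1 else s + 1)"
        using shifted[OF r, of 3] by simp
      ultimately show ?thesis using unshifted[OF r(2)] by (simp only: mult_2 add_ac)
    qed
    have quarter: "t = (s + 1) div 4 \<and> s mod 4 = 3 \<longrightarrow>
        (odd t \<longrightarrow> w 0 = 3 * s \<and> (\<forall>j\<in>{1..<t}. w j = 4 * s)) \<and>
        (even t \<longrightarrow> w 0 = 3 * s + 4 \<and>
           (\<forall>j\<in>{1..<t}. w j = (if odd j then 4 * s - 4 else 4 * s + 4)))"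
    proof
      assume "t = (s + 1) div 4 \<and> s mod 4 = 3"
      moreover have "4 dvd s + 1" if "s mod 4 = 3" using that by presburger
      ultimately have st: "s + 1 = t * 4" using dvd_div_mult_self[of 4 "s + 1"] by simp
      have w0: "w 0 = 1 + 2 * (if odd t then s - 1 else s + 1) + (s + 1)"
        using four[OF st, of 0] t0 by simp
      have wj: "w j = (if odd j then s - 1 else s + 1) +
          2 * (if odd (j + t) then s - 1 else s + 1) + (if odd j then s - 1 else s + 1)"
        if "j \<in> {1..<t}" for j
        using four[OF st, of j] that by simp
      show "(odd t \<longrightarrow> w 0 = 3 * s \<and> (\<forall>j\<in>{1..<t}. w j = 4 * s)) \<and>
        (even t \<longrightarrow> w 0 = 3 * s + 4 \<and>
           (\<forall>j\<in>{1..<t}. w j = (if odd j then 4 * s - 4 else 4 * s + 4)))"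
      proof (intro conjI impI ballI)
        show "w 0 = 3 * s" if "odd t" using w0 that s1 by simp
        show "w 0 = 3 * s + 4" if "even t" using w0 that s1 by simp
        show "w j = 4 * s" if "odd t" "j \<in> {1..<t}" for j
          using wj[OF that(2)] that(1) s1 by (cases "odd j") simp_all
        show "w j = (if odd j then 4 * s - 4 else 4 * s + 4)" if "even t" "j \<in> {1..<t}" for j
          using wj[OF that(2)] that(1) s1 by (cases "odd j") simp_all
      qed
    qed
    show ?case
      unfolding Let_def w_def[abs_def, symmetric] by (intro conjI matrix full half1 half3 quarter)
  qed
qed

end
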